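(* Let $X$ be a finite dimensional strictly convex normed linear space, and let $A\subseteq X$ be a nonempty bounded set. If $A$ is uniquely remotal, then $A$ is a singleton.
   Context: For a nonempty bounded subset $A$ of a normed linear space $X$ and $x\in X$, put $D(x,A)=\sup_{a\in A}\|x-a\|$ and $F(x,A)=\{a\in A:\|x-a\|=D(x,A)\}$. The set $A$ is called uniquely remotal if $F(x,A)$ consists of exactly one point for every $x\in X$. *)

theory Defs
  imports "HOL-Analysis.Analysis"
begin

text \<open>Strict convexity of the norm: the unit sphere contains no nondegenerate segment,
  stated through midpoints.\<close>

definition strictly_convex_space :: "'a::real_normed_vector itself \<Rightarrow> bool" where
  "strictly_convex_space (_ :: 'a itself) \<longleftrightarrow>
     (\<forall>x y :: 'a. norm x = 1 \<longrightarrow> norm y = 1 \<longrightarrow> x \<noteq> y \<longrightarrow> norm ((1/2) *\<^sub>R (x + y)) < 1)"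

definition finite_dimensional_space :: "'a::real_vector itself \<Rightarrow> bool" where
  "finite_dimensional_space (_ :: 'a itself) \<longleftrightarrow>
     (\<exists>B :: 'a set. finite B \<and> span B = UNIV)"

text \<open>The following notions are meant for nonempty bounded sets only: otherwise the supremum
  of reals is unspecified.\<close>

definition farthest_dist :: "'a::real_normed_vector \<Rightarrow> 'a set \<Rightarrow> real" where
  "farthest_dist x A = (SUP a\<in>A. norm (x - a))"

definition farthest_points :: "'a::real_normed_vector \<Rightarrow> 'a set \<Rightarrow> 'a set" where
  "farthest_points x A = {a \<in> A. norm (x - a) = farthest_dist x A}"

definition uniquely_remotal :: "'a::real_normed_vector set \<Rightarrow> bool" where
  "uniquely_remotal A \<longleftrightarrow> (\<forall>x. is_singleton (farthest_points x A))"

end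

theory Submission
  imports Defs
begin

text \<open>
  A bounded set \<open>A\<close> with more than one point has a Chebyshev centre \<open>x\<^sub>0\<close>, a minimiser of the
  farthest distance, and the minimum \<open>r\<close> is positive.  If \<open>q\<close> were the only point of the
  closure of \<open>A\<close> at distance \<open>r\<close> from \<open>x\<^sub>0\<close>, then a small step from \<open>x\<^sub>0\<close> towards
  \<open>q\<close> would decrease the farthest distance: points at distance less than \<open>r\<close> from \<open>q\<close>
  come closer than \<open>r\<close> by convexity of the norm, and the remaining points of the closure form
  a compact set whose distances to \<open>x\<^sub>0\<close> stay a fixed amount below \<open>r\<close>.  That contradicts
  minimality (\<open>unique_farthest_point_at_centre\<close>).

  Unique remotality of \<open>A\<close> speaks only of farthest points in \<open>A\<close>, while the argument above
  concerns its closure.  Strict convexity closes this gap (\<open>farthest_point_of_closure_mem\<close>): a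
  farthest point \<open>b\<close> of the closure, seen from \<open>x\<close>, is the only farthest point seen from
  \<open>2x - b\<close>, and the supremum at \<open>2x - b\<close> is attained in \<open>A\<close>.

  Finite dimension enters through compactness of bounded closed sets, obtained by adding
  the vectors of a spanning set one at a time.
\<close>

section \<open>Compactness of balls in finite dimension\<close>

lemma closed_if_compact_cball_sections:
  fixes S :: "'a::real_normed_vector set"
  assumes "\<And>R. compact (cball 0 R \<inter> S)"
  shows "closed S"
proof -
  have "x \<in> S" if x: "x \<in> closure S" for x
  proof -
    have "x \<in> ball 0 (norm x + 1) \<inter> closure S"
      using x by simp
    also have "\<dots> \<subseteq> closure (ball 0 (norm x + 1) \<inter> S)"
      by (rule open_Int_closure_subset) simp
    also have "\<dots> \<subseteq> closure (cball 0 (norm x + 1) \<inter> S)"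
      by (intro closure_mono) auto
    also have "\<dots> = cball 0 (norm x + 1) \<inter> S"
      using assms compact_imp_closed closure_closed by blast
    finally show ?thesis by simp
  qed
  then show ?thesis
    by (metis closure_subset closure_closed closed_closure subsetI subset_antisym)
qed

text \<open>
  The induction has to be on compactness of the ball sections of a span: compactness of the smaller
  sections makes the smaller span closed, so a new vector \<open>b\<close> has positive distance \<open>d\<close> to
  it, and this \<open>d\<close> bounds the coefficient of \<open>b\<close> in any vector of the larger span.
\<close>

lemma compact_cball_Int_span:
  fixes B :: "'a::real_normed_vector set"
  assumes "finite B"
  shows "compact (cball 0 R \<inter> span B)"
  using assms
proof (induction B arbitrary: R rule: finite_induct)
  case empty
  have "finite (cball 0 R \<inter> span {} :: 'a set)" by simp
  then show ?case by (rule finite_imp_compact)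
next
  case (insert b S)
  show ?case
  proof (cases "b \<in> span S")
    case True
    then show ?thesis using insert.IH by (simp add: span_redundant)
  next
    case False
    have cl: "closed (span S)"
      using insert.IH by (rule closed_if_compact_cball_sections)
    define d where "d = infdist b (span S)"
    have ne: "span S \<noteq> {}" using span_zero by blast
    have d0: "d > 0"
      unfolding d_def
      using False cl ne in_closed_iff_infdist_zero infdist_nonneg by (metis order_le_less)
    have lower: "\<bar>c\<bar> * d \<le> norm x" if "x - c *\<^sub>R b \<in> span S" for x c
    proof (cases "c = 0")
      case True then show ?thesis by simp
    next
      case c: False
      \<comment> \<open>Up to a point of the span, \<open>x / c\<close> is \<open>b\<close>, so its norm is at least \<open>d\<close>.\<close>
      have "(- 1 / c) *\<^sub>R (x - c *\<^sub>R b) \<in> span S"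
        using that by (rule span_scale)
      moreover have "(- 1 / c) *\<^sub>R (x - c *\<^sub>R b) = b - (1/c) *\<^sub>R x"
        using c by (simp add: algebra_simps)
      ultimately have "d \<le> dist b (b - (1/c) *\<^sub>R x)"
        unfolding d_def by (metis infdist_le)
      also have "\<dots> = norm x / \<bar>c\<bar>"
        by (simp add: dist_norm divide_inverse mult.commute)
      finally show ?thesis using c by (simp add: field_simps)
    qed
    define M where "M = R / d"
    define K where "K = (\<lambda>(c, y). c *\<^sub>R b + y) ` ({-M..M} \<times> (cball 0 (R + M * norm b) \<inter> span S))"
    have "compact K"
      unfolding K_def case_prod_unfold
      by (intro compact_continuous_image compact_Times insert.IH continuous_intros)
         simp_all
    moreover have "cball 0 R \<inter> span (insert b S) = cball 0 R \<inter> K"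
    proof (intro equalityI subsetI)
      fix x assume x: "x \<in> cball 0 R \<inter> span (insert b S)"
      then obtain c where c: "x - c *\<^sub>R b \<in> span S"
        by (auto simp: span_insert)
      have "\<bar>c\<bar> * d \<le> R" using lower[OF c] x by simp
      then have cM: "\<bar>c\<bar> \<le> M" using d0 by (simp add: M_def field_simps)
      have "norm (x - c *\<^sub>R b) \<le> norm x + \<bar>c\<bar> * norm b"
        using norm_triangle_ineq4[of x "c *\<^sub>R b"] by simp
      also have "\<dots> \<le> R + M * norm b"
        using x cM by (intro add_mono mult_right_mono) auto
      finally have "(c, x - c *\<^sub>R b) \<in> {-M..M} \<times> (cball 0 (R + M * norm b) \<inter> span S)"
        using c cM by auto
      then have "x \<in> K" unfolding K_def by (rule rev_image_eqI) simp
      then show "x \<in> cball 0 R \<inter> K" using x by simp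
    next
      fix x assume "x \<in> cball 0 R \<inter> K"
      moreover from this obtain c y where "x = c *\<^sub>R b + y" "y \<in> span S"
        unfolding K_def by auto
      then have "x - c *\<^sub>R b \<in> span S" by simp
      ultimately show "x \<in> cball 0 R \<inter> span (insert b S)"
        by (auto simp: span_insert)
    qed
    ultimately show ?thesis by (simp add: closed_Int_compact)
  qed
qed

lemma finite_dimensional_compact:
  fixes S :: "'a::real_normed_vector set"
  assumes "finite_dimensional_space TYPE('a)" "closed S" "bounded S"
  shows "compact S"
proof -
  obtain B :: "'a set" where B: "finite B" "span B = UNIV"
    using assms(1) unfolding finite_dimensional_space_def by blast
  obtain R where R: "\<And>x. x \<in> S \<Longrightarrow> norm x \<le> R"
    using assms(3) unfolding bounded_iff by blast
  have "compact (S \<inter> cball 0 R)"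
    using compact_cball_Int_span[OF B(1), of R] B(2) assms(2)
    by (simp add: closed_Int_compact)
  moreover have "S \<inter> cball 0 R = S" using R by auto
  ultimately show ?thesis by simp
qed

section \<open>The farthest distance\<close>

lemma norm_le_farthest_dist:
  fixes A :: "'a::real_normed_vector set"
  assumes "bounded A" "a \<in> A"
  shows "norm (x - a) \<le> farthest_dist x A"
  unfolding farthest_dist_def
proof (rule cSUP_upper[OF assms(2)])
  have "bounded ((\<lambda>a. x - a) ` A)"
    using bounded_minus_comp[of "\<lambda>_. x" A "\<lambda>a. a"] assms(1) by (simp add: image_constant_conv)
  then show "bdd_above ((\<lambda>a. norm (x - a)) ` A)"
    by (auto simp: bounded_iff bdd_above_def)
qed

lemma norm_le_farthest_dist_closure:
  fixes A :: "'a::real_normed_vector set"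
  assumes "bounded A" "a \<in> closure A"
  shows "norm (x - a) \<le> farthest_dist x A"
proof (rule continuous_le_on_closure[OF _ assms(2)])
  show "continuous_on (closure A) (\<lambda>a. norm (x - a))" by (intro continuous_intros)
qed (rule norm_le_farthest_dist[OF assms(1)])

lemma farthest_dist_le:
  fixes A :: "'a::real_normed_vector set"
  assumes "A \<noteq> {}" "\<And>a. a \<in> A \<Longrightarrow> norm (x - a) \<le> r"
  shows "farthest_dist x A \<le> r"
  unfolding farthest_dist_def using assms by (rule cSUP_least)

lemma farthest_dist_Lipschitz:
  fixes A :: "'a::real_normed_vector set"
  assumes "A \<noteq> {}" "bounded A"
  shows "farthest_dist x A \<le> farthest_dist y A + norm (x - y)"
proof (rule farthest_dist_le[OF assms(1)])
  fix a assume "a \<in> A"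
  then have "norm (y - a) \<le> farthest_dist y A"
    using assms(2) norm_le_farthest_dist by blast
  then show "norm (x - a) \<le> farthest_dist y A + norm (x - y)"
    using norm_triangle_ineq[of "x - y" "y - a"] by simp
qed

lemma continuous_on_farthest_dist:
  fixes A :: "'a::real_normed_vector set"
  assumes "A \<noteq> {}" "bounded A"
  shows "continuous_on S (\<lambda>x. farthest_dist x A)"
proof -
  have "dist (farthest_dist x A) (farthest_dist y A) \<le> dist x y" for x y
    using farthest_dist_Lipschitz[OF assms, of x y] farthest_dist_Lipschitz[OF assms, of y x]
    by (auto simp: dist_norm norm_minus_commute abs_le_iff)
  then show ?thesis
    unfolding continuous_on_iff by (meson le_less_trans)
qed

lemma Chebyshev_centre_exists:
  fixes A :: "'a::real_normed_vector set"
  assumes "finite_dimensional_space TYPE('a)" "A \<noteq> {}" "bounded A"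
  obtains c where "\<And>x. farthest_dist c A \<le> farthest_dist x A"
proof -
  obtain a where a: "a \<in> A" using assms(2) by blast
  let ?C = "cball a (farthest_dist a A)"
  have a_in: "a \<in> ?C" using norm_le_farthest_dist[OF assms(3) a, of a] by simp
  have "compact ?C" using assms(1) by (simp add: finite_dimensional_compact)
  then obtain c where c: "\<And>x. x \<in> ?C \<Longrightarrow> farthest_dist c A \<le> farthest_dist x A"
    using continuous_attains_inf[OF _ _ continuous_on_farthest_dist[OF assms(2,3)]] a_in
    by (metis empty_iff)
  have "farthest_dist c A \<le> farthest_dist x A" for x
  proof (cases "x \<in> ?C")
    case False
    then have "farthest_dist a A \<le> norm (x - a)"
      by (simp add: dist_norm norm_minus_commute)
    also have "\<dots> \<le> farthest_dist x A"
      using norm_le_farthest_dist[OF assms(3) a] .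
    finally show ?thesis using c[OF a_in] by simp
  qed (rule c)
  then show ?thesis by (rule that)
qed

section \<open>Farthest points of the closure\<close>

lemma strictly_convex_eq:
  fixes u v :: "'a::real_normed_vector"
  assumes "strictly_convex_space TYPE('a)"
    and "norm u \<le> r" "norm v \<le> r" "norm (u + v) = 2 * r"
  shows "u = v"
proof (cases "r = 0")
  case True
  then show ?thesis using assms by simp
next
  case False
  then have r: "r > 0" using norm_ge_zero[of u] assms(2) by linarith
  have uv: "norm u = r" "norm v = r"
    using norm_triangle_ineq[of u v] assms by auto
  have "norm ((1/2) *\<^sub>R ((1/r) *\<^sub>R u + (1/r) *\<^sub>R v)) = 1"
    using r assms(4) by (simp flip: scaleR_right_distrib)
  moreover have "norm ((1/r) *\<^sub>R u) = 1" "norm ((1/r) *\<^sub>R v) = 1"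
    using r uv by simp_all
  ultimately have "(1/r) *\<^sub>R u = (1/r) *\<^sub>R v"
    using assms(1) unfolding strictly_convex_space_def by fastforce
  then show ?thesis using r by simp
qed

text \<open>
  Reflecting \<open>b\<close> in \<open>x\<close> doubles its distance, so seen from \<open>2x - b\<close> the
  farthest distance is \<open>2r\<close>; a point of \<open>A\<close> attaining it gives equality in the triangle
  inequality through \<open>x\<close>, which under strict convexity only \<open>b\<close> itself can do.
\<close>

lemma farthest_point_of_closure_mem:
  fixes A :: "'a::real_normed_vector set"
  assumes "strictly_convex_space TYPE('a)" "A \<noteq> {}" "bounded A"
    and attained: "\<And>x. farthest_points x A \<noteq> {}"
    and b: "b \<in> closure A" "norm (x - b) = farthest_dist x A"
  shows "b \<in> A"
proof -
  define r where "r = farthest_dist x A"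
  define y where "y = x + (x - b)"
  have tri: "norm (y - a) \<le> 2 * r" if "a \<in> A" for a
  proof -
    have "norm (y - a) \<le> norm (x - a) + norm (x - b)"
      using norm_triangle_ineq[of "x - a" "x - b"] by (simp add: y_def algebra_simps)
    then show ?thesis
      using norm_le_farthest_dist[OF assms(3) that, of x] b(2) by (simp add: r_def)
  qed
  have "y - b = 2 *\<^sub>R (x - b)" by (simp add: y_def scaleR_2)
  then have "norm (y - b) = 2 * r" using b(2) by (simp add: r_def)
  then have D: "farthest_dist y A = 2 * r"
    using norm_le_farthest_dist_closure[OF assms(3) b(1), of y] farthest_dist_le[OF assms(2) tri]
    by simp
  obtain a where a: "a \<in> A" "norm (y - a) = 2 * r"
    using attained[of y] D unfolding farthest_points_def by auto
  have "x - a = x - b"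
  proof (rule strictly_convex_eq[OF assms(1)])
    show "norm (x - a) \<le> r" using norm_le_farthest_dist[OF assms(3) a(1)] by (simp add: r_def)
    show "norm (x - b) \<le> r" using b(2) by (simp add: r_def)
    show "norm ((x - a) + (x - b)) = 2 * r" using a(2) by (simp add: y_def algebra_simps)
  qed
  then show ?thesis using a(1) by simp
qed

section \<open>A unique farthest point at a centre\<close>

text \<open>
  A positive radius would shrink under a small step from \<open>c\<close> towards \<open>q\<close>.  The points at
  distance at least the radius from \<open>q\<close> get no benefit from convexity and need the gap \<open>e\<close>;
  the step is short enough not to use up that gap.
\<close>

lemma unique_farthest_point_at_centre:
  fixes K :: "'a::real_normed_vector set"
  assumes "compact K" "q \<in> K"
    and le: "\<And>a. a \<in> K \<Longrightarrow> norm (c - a) \<le> r"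
    and uniq: "\<And>a. a \<in> K \<Longrightarrow> norm (c - a) = r \<Longrightarrow> a = q"
    and centre: "\<And>x. \<exists>a\<in>K. r \<le> norm (x - a)"
  shows "r = 0"
proof (rule ccontr)
  assume "r \<noteq> 0"
  then have r: "r > 0" using le[OF assms(2)] norm_ge_zero[of "c - q"] by linarith
  let ?L = "K - ball q r"
  have "compact ?L" using assms(1) by (intro compact_diff) simp_all
  obtain e where e: "e > 0" "\<And>a. a \<in> ?L \<Longrightarrow> norm (c - a) \<le> r - e"
  proof (cases "?L = {}")
    case True
    then show ?thesis using that[of 1] by (metis empty_iff zero_less_one)
  next
    case False
    have "continuous_on ?L (\<lambda>a. norm (c - a))" by (intro continuous_intros)
    then obtain m where m: "m \<in> ?L" "\<And>a. a \<in> ?L \<Longrightarrow> norm (c - a) \<le> norm (c - m)"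
      using continuous_attains_sup[OF \<open>compact ?L\<close> False] by blast
    have "m \<noteq> q" using m(1) r by auto
    then have "norm (c - m) < r" using le[of m] uniq[of m] m(1) by force
    then show ?thesis using that[of "r - norm (c - m)"] m(2) by simp
  qed
  define t where "t = min 1 (e / (2 * r))"
  have t: "0 < t" "t \<le> 1" "t * r < e"
  proof -
    have "t * r \<le> (e / (2 * r)) * r" using r by (intro mult_right_mono) (auto simp: t_def)
    then show "t * r < e" using r e(1) by simp
  qed (use r e(1) in \<open>auto simp: t_def\<close>)
  define x where "x = c + t *\<^sub>R (q - c)"
  have "norm (x - a) < r" if a: "a \<in> K" for a
  proof (cases "a \<in> ball q r")
    case True
    have "x - a = (1 - t) *\<^sub>R (c - a) + t *\<^sub>R (q - a)"
      by (simp add: x_def algebra_simps)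
    then have "norm (x - a) \<le> (1 - t) * norm (c - a) + t * norm (q - a)"
      using norm_triangle_ineq[of "(1 - t) *\<^sub>R (c - a)" "t *\<^sub>R (q - a)"] t by simp
    also have "\<dots> < (1 - t) * r + t * r"
      using True le[OF a] t
      by (intro add_le_less_mono mult_left_mono mult_strict_left_mono) (auto simp: dist_norm)
    finally show ?thesis by (simp add: algebra_simps)
  next
    case False
    have "norm (x - a) \<le> norm (c - a) + t * norm (q - c)"
      using norm_triangle_ineq[of "c - a" "t *\<^sub>R (q - c)"] t by (simp add: x_def add_diff_eq diff_add_eq)
    also have "\<dots> \<le> (r - e) + t * r"
      using False a e(2) le[OF assms(2)] t
      by (intro add_mono mult_left_mono) (auto simp: norm_minus_commute)
    finally show ?thesis using t(3) by simp
  qed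
  then show False using centre[of x] by force
qed

section \<open>Uniquely remotal sets\<close>

theorem theorem2p2:
  fixes A :: "'a::real_normed_vector set"
  assumes "finite_dimensional_space TYPE('a)"
    and "strictly_convex_space TYPE('a)"
    and "A \<noteq> {}"
    and "bounded A"
    and "uniquely_remotal A"
  shows "is_singleton A"
proof -
  have sing: "is_singleton (farthest_points x A)" for x
    using assms(5) unfolding uniquely_remotal_def by blast
  then have attained: "farthest_points x A \<noteq> {}" for x
    by (metis is_singleton_def insert_not_empty)
  obtain c where c: "\<And>x. farthest_dist c A \<le> farthest_dist x A"
    using Chebyshev_centre_exists[OF assms(1,3,4)] by blast
  obtain q where q: "farthest_points c A = {q}"
    using sing[of c] by (auto simp: is_singleton_def)
  then have qA: "q \<in> A" unfolding farthest_points_def by blast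
  have "farthest_dist c A = 0"
  proof (rule unique_farthest_point_at_centre)
    show "compact (closure A)"
      using assms(1,4) by (intro finite_dimensional_compact) auto
    show "q \<in> closure A" using qA closure_subset by blast
    show "norm (c - a) \<le> farthest_dist c A" if "a \<in> closure A" for a
      using assms(4) that by (rule norm_le_farthest_dist_closure)
    show "a = q" if "a \<in> closure A" "norm (c - a) = farthest_dist c A" for a
    proof -
      have "a \<in> A" using farthest_point_of_closure_mem[OF assms(2,3,4) attained that] .
      then have "a \<in> farthest_points c A" using that(2) by (simp add: farthest_points_def)
      then show ?thesis using q by simp
    qed
    show "\<exists>a\<in>closure A. farthest_dist c A \<le> norm (x - a)" for x
    proof -
      obtain a where a: "a \<in> A" "norm (x - a) = farthest_dist x A"
        using attained[of x] unfolding farthest_points_def by blast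
      have "a \<in> closure A" using a(1) closure_subset by blast
      moreover have "farthest_dist c A \<le> norm (x - a)" using c[of x] a(2) by simp
      ultimately show ?thesis by blast
    qed
  qed
  then have "a = c" if "a \<in> A" for a
    using norm_le_farthest_dist[OF assms(4) that, of c] by simp
  then have "A = {c}" using assms(3) by blast
  then show ?thesis by (simp add: is_singleton_def)
qed

end
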